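(* Let $d\ge 1$ be an integer, let $a_1,\ldots,a_d>0$ and let $\lambda$ be a real number. Then $$\det(\boldsymbol{M}_\lambda-\boldsymbol{I})=(-1)^d\left[1-\sum_{\ell=2}^{d}(\ell-1)\lambda^\ell\sum_{\substack{S\subset\{1,\ldots,d\}\\ |S|=\ell}}\ \prod_{i\in S}a_i\right].$$
   Context: $\boldsymbol{M}_\lambda$ is the $d\times d$ matrix whose diagonal entries are $0$ and whose $(i,j)$ entry for $i\ne j$ is $\lambda a_j$; $\boldsymbol{I}$ is the $d\times d$ identity matrix. *)

theory Defs
  imports "Jordan_Normal_Form.Determinant"
begin

text \<open>
  Matrix rows and columns are numbered from \<open>0\<close> to \<open>d - 1\<close>, whereas the weights
  \<open>a 1, \<dots>, a d\<close> are numbered from \<open>1\<close> to \<open>d\<close>: column \<open>j\<close> carries the weight \<open>a (Suc j)\<close>.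
\<close>

definition M_mat :: "nat \<Rightarrow> (nat \<Rightarrow> real) \<Rightarrow> real \<Rightarrow> real mat" where
  "M_mat d a lam = mat d d (\<lambda>(i, j). if i = j then 0 else lam * a (Suc j))"

end

theory Submission
  imports Defs
begin

text \<open>
  Put \<open>x j = lam * a (Suc j)\<close>. The matrix is \<open>diag c + 1 x\<^sup>T\<close> with \<open>c j = - 1 - x j\<close>. Expanding its
  determinant along the last column, which splits as \<open>c\<^sub>n e\<^sub>n + x\<^sub>n 1\<close>, gives the recursion
  \<open>D\<^sub>n\<^sub>+\<^sub>1 = c\<^sub>n D\<^sub>n + x\<^sub>n \<Prod>\<^sub>i c\<^sub>i\<close>. The subset sum of \<open>(1 - card S) * \<Prod>\<^sub>S x\<close> satisfies the same
  recursion up to sign, because the subset sum of \<open>\<Prod>\<^sub>S x\<close> is \<open>\<Prod>\<^sub>i (1 + x\<^sub>i)\<close>. Grouping the subsets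
  by cardinality finishes the proof; those of cardinality \<open>1\<close> have coefficient \<open>0\<close>.
\<close>

text \<open>Subtracting \<open>x j\<close> times the last column of ones from each earlier column
  \<open>j\<close> leaves an upper triangular matrix with diagonal \<open>c 0\<close>, ...,
  \<open>c (n - 1)\<close>, \<open>1\<close>.\<close>

lemma det_diag_plus_row_last_ones:
  fixes c x :: "nat \<Rightarrow> 'a :: comm_ring_1"
  shows "det (mat (Suc n) (Suc n)
      (\<lambda>(i, j). if j = n then 1 else (if i = j then c j else 0) + x j)) = (\<Prod>i<n. c i)"
    (is "det ?B = _")
proof -
  \<comment> \<open>Clear the columns before the last by column operations, written as a factorisation.\<close>
  define T where "T = mat (Suc n) (Suc n)
    (\<lambda>(i, j). if j = n then 1 else if i = j then c j else 0)"
  define L where "L = mat (Suc n) (Suc n)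
    (\<lambda>(i, j). if i = j then 1 else if i = n then x j else 0)"
  have T: "T \<in> carrier_mat (Suc n) (Suc n)" and L: "L \<in> carrier_mat (Suc n) (Suc n)"
    by (auto simp: T_def L_def)
  have "?B = T * L"
  proof (rule eq_matI)
    fix i j assume "i < dim_row (T * L)" "j < dim_col (T * L)"
    then have ij: "i < Suc n" "j < Suc n" using T L by auto
    have "(T * L) $$ (i, j) = (\<Sum>k<Suc n. T $$ (i, k) * L $$ (k, j))"
      using T L ij by (simp add: scalar_prod_def atLeast0LessThan)
    \<comment> \<open>Column \<open>j\<close> of \<open>L\<close> is zero off the diagonal except in
      row \<open>n\<close>, so the term \<open>k = n\<close> is split off; it supplies the multiple
      of the column of ones.\<close>
    also have "\<dots> = (\<Sum>k<n. if k = j then if i = j then c j else 0 else 0)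
        + (if j = n then 1 else x j)"
      using ij unfolding sum.lessThan_Suc
      by (intro arg_cong2[where f = "(+)"] sum.cong) (auto simp: T_def L_def)
    also have "\<dots> = ?B $$ (i, j)"
      using ij by (auto simp: sum.delta')
    finally show "?B $$ (i, j) = (T * L) $$ (i, j)" by simp
  qed (use T L in auto)
  moreover have "det T = (\<Prod>i<n. c i)"
  proof -
    have "upper_triangular T"
      by (auto simp: upper_triangular_def T_def)
    moreover have "diag_mat T = map c [0..<n] @ [1]"
      by (auto simp: diag_mat_def T_def)
    ultimately show ?thesis
      using det_upper_triangular[OF _ T]
      by (simp add: prod.distinct_set_conv_list[symmetric] atLeast0LessThan)
  qed
  moreover have "det L = 1"
  proof -
    have "diag_mat L = map (\<lambda>_. 1) [0..<Suc n]"
      by (auto simp: diag_mat_def L_def)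
    then show ?thesis
      using det_lower_triangular[OF _ L]
      by (auto simp: L_def map_replicate_const)
  qed
  ultimately show ?thesis
    using det_mult[OF T L] by simp
qed

text \<open>Linearity in the last column: its diagonal part leaves the minor \<open>A n\<close>, and
  its constant part is \<open>x n\<close> times a column of ones.\<close>

lemma det_diag_plus_row_Suc:
  fixes c x :: "nat \<Rightarrow> 'a :: comm_ring_1"
  defines "A \<equiv> \<lambda>n. mat n n (\<lambda>(i, j). (if i = j then c j else 0) + x j)"
  shows "det (A (Suc n)) = c n * det (A n) + x n * (\<Prod>i<n. c i)"
proof -
  define B where "B = mat (Suc n) (Suc n)
    (\<lambda>(i, j). if j = n then 1 else (if i = j then c j else 0) + x j)"
  \<comment> \<open>The two matrices differ only in column \<open>n\<close>, which these cofactors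
    delete.\<close>
  have cof: "cofactor (A (Suc n)) i n = cofactor B i n" if "i < Suc n" for i
    unfolding cofactor_def using that
    by (intro arg_cong2[where f = "(*)"] arg_cong[where f = det])
      (auto simp: mat_delete_def A_def B_def)
  have "cofactor (A (Suc n)) n n = det (A n)"
    unfolding cofactor_def
    by (auto simp: mat_delete_def A_def intro!: arg_cong[where f = det])
  have "det (A (Suc n)) = (\<Sum>i<Suc n. A (Suc n) $$ (i, n) * cofactor (A (Suc n)) i n)"
    by (rule laplace_expansion_column) (auto simp: A_def)
  \<comment> \<open>The factor \<open>B $$ (i, n)\<close> is \<open>1\<close>; writing it turns the
    second part into the Laplace expansion of \<open>det B\<close>.\<close>
  also have "\<dots> = (\<Sum>i<Suc n. (if i = n then c n * cofactor (A (Suc n)) i n else 0)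
      + x n * (B $$ (i, n) * cofactor B i n))"
  proof (rule sum.cong)
    fix i assume "i \<in> {..<Suc n}"
    then have "A (Suc n) $$ (i, n) = (if i = n then c n else 0) + x n" "B $$ (i, n) = 1"
      "cofactor (A (Suc n)) i n = cofactor B i n"
      by (auto simp: cof) (auto simp: A_def B_def)
    then show "A (Suc n) $$ (i, n) * cofactor (A (Suc n)) i n =
        (if i = n then c n * cofactor (A (Suc n)) i n else 0) + x n * (B $$ (i, n) * cofactor B i n)"
      by (auto simp: algebra_simps)
  qed simp
  also have "\<dots> = c n * cofactor (A (Suc n)) n n
      + x n * (\<Sum>i<Suc n. B $$ (i, n) * cofactor B i n)"
    by (simp add: sum.distrib sum_distrib_left sum.delta algebra_simps)
  also have "(\<Sum>i<Suc n. B $$ (i, n) * cofactor B i n) = det B"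
    by (rule laplace_expansion_column[symmetric]) (auto simp: B_def)
  also have "det B = (\<Prod>i<n. c i)"
    unfolding B_def by (rule det_diag_plus_row_last_ones)
  finally show ?thesis
    using \<open>cofactor (A (Suc n)) n n = det (A n)\<close> by simp
qed

lemma sum_Pow_insert:
  assumes "finite A" "b \<notin> A"
  shows "(\<Sum>S\<in>Pow (insert b A). f S) = (\<Sum>S\<in>Pow A. f S) + (\<Sum>S\<in>Pow A. f (insert b S))"
proof -
  have "inj_on (insert b) (Pow A)"
    using assms(2) by (auto simp: inj_on_def)
  then show ?thesis
    using assms unfolding Pow_insert
    by (subst sum.union_disjoint) (auto simp: sum.reindex)
qed

text \<open>Subsets are split by membership of \<open>b\<close>. Adding \<open>b\<close> to
  \<open>S\<close> multiplies the product by \<open>x b\<close> and lowers the coefficient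
  \<open>1 - card S\<close> by one; the lowering accounts for the subtracted term.\<close>

lemma sum_Pow_card_prod_insert:
  fixes x :: "'b \<Rightarrow> 'a :: comm_ring_1"
  assumes "finite A" "b \<notin> A"
  defines "Q \<equiv> \<lambda>A. \<Sum>S\<in>Pow A. (1 - of_nat (card S)) * (\<Prod>i\<in>S. x i)"
  shows "Q (insert b A) = (1 + x b) * Q A - x b * (\<Prod>i\<in>A. 1 + x i)"
proof -
  have "(\<Sum>S\<in>Pow A. (1 - of_nat (card (insert b S))) * (\<Prod>i\<in>insert b S. x i))
      = (\<Sum>S\<in>Pow A. x b * ((1 - of_nat (card S)) * (\<Prod>i\<in>S. x i)) - x b * (\<Prod>i\<in>S. x i))"
  proof (rule sum.cong)
    fix S assume "S \<in> Pow A"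
    then have "finite S" "b \<notin> S"
      using assms by (auto intro: finite_subset)
    then show "(1 - of_nat (card (insert b S))) * (\<Prod>i\<in>insert b S. x i)
        = x b * ((1 - of_nat (card S)) * (\<Prod>i\<in>S. x i)) - x b * (\<Prod>i\<in>S. x i)"
      by (simp add: algebra_simps)
  qed simp
  also have "\<dots> = x b * Q A - x b * (\<Sum>S\<in>Pow A. \<Prod>i\<in>S. x i)"
    unfolding Q_def sum_subtractf sum_distrib_left ..
  \<comment> \<open>Expanding the product chooses \<open>x i\<close> for \<open>i\<close> in
    \<open>S\<close> and \<open>1\<close> elsewhere.\<close>
  also have "(\<Sum>S\<in>Pow A. \<Prod>i\<in>S. x i) = (\<Prod>i\<in>A. x i + 1)"
    using assms(1) by (simp add: prod_add)
  finally show ?thesis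
    unfolding Q_def sum_Pow_insert[OF assms(1,2)]
    by (simp add: algebra_simps)
qed

text \<open>Since \<open>c j\<close> is minus \<open>1 + lam * a (Suc j)\<close>, each recursion
  step contributes one sign; at size \<open>0\<close> both sides are \<open>1\<close>.\<close>

lemma det_M_mat_minus_one:
  "det (M_mat d a lam - 1\<^sub>m d) =
    (-1) ^ d * (\<Sum>S\<in>Pow {1..d}. (1 - real (card S)) * (\<Prod>i\<in>S. lam * a i))"
proof -
  define c x where "c = (\<lambda>j. - 1 - lam * a (Suc j))" and "x = (\<lambda>j. lam * a (Suc j))"
  define A where "A = (\<lambda>n. mat n n (\<lambda>(i, j). (if i = j then c j else 0) + x j))"
  define Q where
    "Q = (\<lambda>n. \<Sum>S\<in>Pow {1..n}. (1 - real (card S)) * (\<Prod>i\<in>S. lam * a i))"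
  have "M_mat d a lam - 1\<^sub>m d = A d"
    by (auto simp: M_mat_def A_def c_def x_def)
  moreover have "det (A n) = (-1) ^ n * Q n" for n
  proof (induction n)
    case 0
    show ?case by (simp add: A_def Q_def)
  next
    case (Suc n)
    have "(\<Prod>i<n. c i) = (\<Prod>i<n. (-1) * (1 + lam * a (Suc i)))"
      by (simp add: c_def)
    also have "\<dots> = (-1) ^ n * (\<Prod>i=1..n. 1 + lam * a i)"
      by (simp only: prod.distrib prod_constant card_lessThan)
        (simp add: prod.atLeast1_atMost_eq)
    finally have prod_c: "(\<Prod>i<n. c i) = (-1) ^ n * (\<Prod>i=1..n. 1 + lam * a i)" .
    have "det (A (Suc n)) = c n * det (A n) + x n * (\<Prod>i<n. c i)"
      unfolding A_def by (rule det_diag_plus_row_Suc)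
    also have "\<dots> = (-1) ^ Suc n * ((1 + lam * a (Suc n)) * Q n
        - lam * a (Suc n) * (\<Prod>i=1..n. 1 + lam * a i))"
      unfolding Suc.IH prod_c by (simp add: c_def x_def algebra_simps)
    also have "(1 + lam * a (Suc n)) * Q n - lam * a (Suc n) * (\<Prod>i=1..n. 1 + lam * a i) = Q (Suc n)"
      using sum_Pow_card_prod_insert[of "{1..n}" "Suc n" "\<lambda>i. lam * a i"]
      by (simp add: Q_def atLeastAtMostSuc_conv)
    finally show ?case .
  qed
  ultimately show ?thesis by (simp add: Q_def)
qed

theorem lemma1p3:
  fixes d :: nat and a :: "nat \<Rightarrow> real" and lam :: real
  assumes "d \<ge> 1"
    and "\<And>i. i \<in> {1..d} \<Longrightarrow> a i > 0"
  shows "det (M_mat d a lam - 1\<^sub>m d) =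
    (-1) ^ d * (1 - (\<Sum>l = 2..d. (real l - 1) * lam ^ l *
      (\<Sum>S | S \<subseteq> {1..d} \<and> card S = l. \<Prod>i\<in>S. a i)))"
proof -
  define e where "e = (\<lambda>l. \<Sum>S | S \<subseteq> {1..d} \<and> card S = l. \<Prod>i\<in>S. a i)"
  have "{S. S \<subseteq> {1..d} \<and> card S = 0} = {{}}"
    by (auto dest: finite_subset)
  then have "e 0 = 1"
    by (simp add: e_def)
  have "(\<Sum>S\<in>Pow {1..d}. (1 - real (card S)) * (\<Prod>i\<in>S. lam * a i))
      = (\<Sum>l\<le>d. \<Sum>S | S \<in> Pow {1..d} \<and> card S = l. (1 - real (card S)) * (\<Prod>i\<in>S. lam * a i))"
    by (rule sum.group[symmetric]) (auto dest: card_mono[rotated])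
  \<comment> \<open>Each product over a set of cardinality \<open>l\<close> yields the factor
    \<open>lam ^ l\<close>.\<close>
  also have "\<dots> = (\<Sum>l\<le>d. (1 - real l) * lam ^ l * e l)"
    unfolding e_def sum_distrib_left
    by (intro sum.cong) (auto simp: prod.distrib)
  \<comment> \<open>The index \<open>0\<close> gives the leading \<open>1\<close> and the
    coefficient at \<open>1\<close> vanishes; \<open>d \<ge> 1\<close> puts the index
    \<open>1\<close> in range.\<close>
  also have "{..d} = {0, 1} \<union> {2..d}"
    using assms(1) by auto
  also have "(\<Sum>l\<in>{0, 1} \<union> {2..d}. (1 - real l) * lam ^ l * e l)
      = e 0 + (\<Sum>l=2..d. (1 - real l) * lam ^ l * e l)"
    by (subst sum.union_disjoint) auto
  also note \<open>e 0 = 1\<close>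
  also have "(\<Sum>l=2..d. (1 - real l) * lam ^ l * e l)
      = - (\<Sum>l=2..d. (real l - 1) * lam ^ l * e l)"
    by (simp add: sum_negf[symmetric] algebra_simps)
  finally show ?thesis
    by (simp add: det_M_mat_minus_one e_def)
qed

end
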